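(* Let $\omega\in P^n$. Any highest weight $U_v$-module of highest weight $\omega$ is isomorphic to a quotient of the Verma module $V(\omega)$.
   Context: $n\ge2$ is an integer, $v$ an indeterminate, ground field $\mathbb Q(v)$, $P=\mathbb Q(v)\setminus\{0\}$. Let $\epsilon_1,\dots,\epsilon_n$ be orthonormal for $(\cdot,\cdot)$ and $\alpha_j=\epsilon_j-\epsilon_{j+1}$. The quantum queer superalgebra $U_v=U_v(\mathfrak q_n)$ is the $\mathbb Q(v)$-superalgebra generated by even $\mathsf K_i,\mathsf K_i^{-1},\mathsf E_j,\mathsf F_j$ and odd $\mathsf K_{\bar i},\mathsf E_{\bar j},\mathsf F_{\bar j}$ ($1\le i\le n$, $1\le j\le n-1$) with relations (for all indices for which they make sense): (QQ1) $\mathsf K_i\mathsf K_i^{-1}=\mathsf K_i^{-1}\mathsf K_i=1$, $\mathsf K_i\mathsf K_j=\mathsf K_j\mathsf K_i$, $\mathsf K_i\mathsf K_{\bar j}=\mathsf K_{\bar j}\mathsf K_i$, $\mathsf K_{\bar i}\mathsf K_{\bar j}+\mathsf K_{\bar j}\mathsf K_{\bar i}=2\delta_{i,j}\frac{\mathsf K_i^2-\mathsf K_i^{-2}}{v^2-v^{-2}}$; (QQ2) $\mathsf K_iX=v^{(\epsilon_i,\alpha_j)}X\mathsf K_i$ for $X=\mathsf E_j,\mathsf E_{\bar j}$; $\mathsf K_iX=v^{-(\epsilon_i,\alpha_j)}X\mathsf K_i$ for $X=\mathsf F_j,\mathsf F_{\bar j}$; (QQ3) $\mathsf K_{\bar i}\mathsf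 E_i-v\mathsf E_i\mathsf K_{\bar i}=\mathsf E_{\bar i}\mathsf K_i^{-1}$, $v\mathsf K_{\bar i}\mathsf E_{i-1}-\mathsf E_{i-1}\mathsf K_{\bar i}=-\mathsf K_i^{-1}\mathsf E_{\overline{i-1}}$, $\mathsf K_{\bar i}\mathsf F_i-v\mathsf F_i\mathsf K_{\bar i}=-\mathsf F_{\bar i}\mathsf K_i$, $v\mathsf K_{\bar i}\mathsf F_{i-1}-\mathsf F_{i-1}\mathsf K_{\bar i}=\mathsf K_i\mathsf F_{\overline{i-1}}$, $\mathsf K_{\bar i}\mathsf E_{\bar i}+v\mathsf E_{\bar i}\mathsf K_{\bar i}=\mathsf E_i\mathsf K_i^{-1}$, $v\mathsf K_{\bar i}\mathsf E_{\overline{i-1}}+\mathsf E_{\overline{i-1}}\mathsf K_{\bar i}=\mathsf K_i^{-1}\mathsf E_{i-1}$, $\mathsf K_{\bar i}\mathsf F_{\bar i}+v\mathsf F_{\bar i}\mathsf K_{\bar i}=\mathsf F_i\mathsf K_i$, $v\mathsf K_{\bar i}\mathsf F_{\overline{i-1}}+\mathsf F_{\overline{i-1}}\mathsf K_{\bar i}=\mathsf K_i\mathsf F_{i-1}$, and for $j\ne i,i-1$: $\mathsf K_{\bar i}\mathsf E_j-\mathsf E_j\mathsf K_{\bar i}=\mathsf K_{\bar i}\mathsf F_j-\mathsf F_j\mathsf K_{\bar i}=\mathsf K_{\bar i}\mathsf E_{\bar j}+\mathsf E_{\bar j}\mathsf K_{\bar i}=\mathsf K_{\bar i}\mathsf F_{\bar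 j}+\mathsf F_{\bar j}\mathsf K_{\bar i}=0$; (QQ4) $\mathsf E_i\mathsf F_j-\mathsf F_j\mathsf E_i=\delta_{i,j}\frac{\mathsf K_i\mathsf K_{i+1}^{-1}-\mathsf K_i^{-1}\mathsf K_{i+1}}{v-v^{-1}}$, $\mathsf E_{\bar i}\mathsf F_{\bar j}+\mathsf F_{\bar j}\mathsf E_{\bar i}=\delta_{i,j}\big(\frac{\mathsf K_i\mathsf K_{i+1}-\mathsf K_i^{-1}\mathsf K_{i+1}^{-1}}{v-v^{-1}}+(v-v^{-1})\mathsf K_{\bar i}\mathsf K_{\overline{i+1}}\big)$, $\mathsf E_i\mathsf F_{\bar j}-\mathsf F_{\bar j}\mathsf E_i=\delta_{i,j}(\mathsf K_{i+1}^{-1}\mathsf K_{\bar i}-\mathsf K_{\overline{i+1}}\mathsf K_i^{-1})$, $\mathsf E_{\bar i}\mathsf F_j-\mathsf F_j\mathsf E_{\bar i}=\delta_{i,j}(\mathsf K_{i+1}\mathsf K_{\bar i}-\mathsf K_{\overline{i+1}}\mathsf K_i)$; (QQ5) $\mathsf E_{\bar i}^2=-\frac{v-v^{-1}}{v+v^{-1}}\mathsf E_i^2$, $\mathsf F_{\bar i}^2=\frac{v-v^{-1}}{v+v^{-1}}\mathsf F_i^2$; for $|i-j|\ne1$: $\mathsf E_i\mathsf E_{\bar j}=\mathsf E_{\bar j}\mathsf E_i$, $\mathsf F_i\mathsf F_{\bar j}=\mathsf F_{\bar j}\mathsf F_i$; for $|i-j|>1$: $\mathsf E_i\mathsf E_j=\mathsf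 E_j\mathsf E_i$, $\mathsf F_i\mathsf F_j=\mathsf F_j\mathsf F_i$, $\mathsf E_{\bar i}\mathsf E_{\bar j}=-\mathsf E_{\bar j}\mathsf E_{\bar i}$, $\mathsf F_{\bar i}\mathsf F_{\bar j}=-\mathsf F_{\bar j}\mathsf F_{\bar i}$; $\mathsf E_i\mathsf E_{i+1}-v\mathsf E_{i+1}\mathsf E_i=\mathsf E_{\bar i}\mathsf E_{\overline{i+1}}+v\mathsf E_{\overline{i+1}}\mathsf E_{\bar i}$, $\mathsf E_i\mathsf E_{\overline{i+1}}-v\mathsf E_{\overline{i+1}}\mathsf E_i=\mathsf E_{\bar i}\mathsf E_{i+1}-v\mathsf E_{i+1}\mathsf E_{\bar i}$, $\mathsf F_i\mathsf F_{i+1}-v\mathsf F_{i+1}\mathsf F_i=-(\mathsf F_{\bar i}\mathsf F_{\overline{i+1}}+v\mathsf F_{\overline{i+1}}\mathsf F_{\bar i})$, $\mathsf F_i\mathsf F_{\overline{i+1}}-v\mathsf F_{\overline{i+1}}\mathsf F_i=\mathsf F_{\bar i}\mathsf F_{i+1}-v\mathsf F_{i+1}\mathsf F_{\bar i}$; (QQ6) for $|i-j|=1$: $\mathsf E_i^2X-(v+v^{-1})\mathsf E_iX\mathsf E_i+X\mathsf E_i^2=0$ for $X=\mathsf E_j,\mathsf E_{\bar j}$, and $\mathsf F_i^2Y-(v+v^{-1})\mathsf F_iY\mathsf F_i+Y\mathsf F_i^2=0$ for $Y=\mathsf F_j,\mathsf F_{\bar j}$. For a $U_v$-module $M$ (left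 module) and $\omega\in P^n$: $M_\omega=\{m\in M:\mathsf K_im=\omega_im,\ 1\le i\le n\}$. A nonzero $m\in M_\omega$ with $\mathsf E_jm=\mathsf E_{\bar j}m=0$ for all $1\le j\le n-1$ is a highest weight vector of weight $\omega$; $M$ is a highest weight module of highest weight $\omega$ if it is generated by a highest weight vector of weight $\omega$. $I(\omega)$ is the left ideal of $U_v$ generated by $\{\mathsf K_i-\omega_i\cdot1,\ \mathsf E_j,\ \mathsf E_{\bar j}:1\le i\le n,\ 1\le j\le n-1\}$, and the Verma module is $V(\omega)=U_v/I(\omega)$. *)

theory Defs
  imports
    "HOL-Computational_Algebra.Fraction_Field"
    "HOL-Computational_Algebra.Polynomial"
    "HOL-Library.Poly_Mapping"
    "HOL-Algebra.QuotRing"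
    "HOL-Algebra.Module"
begin

section \<open>Left modules over a not necessarily commutative ring\<close>

text \<open>
  HOL-Algebra's locale \<open>module\<close> requires a commutative ring. Its record type \<open>module\<close> and its
  locale \<open>submodule\<close> (an additive subgroup closed under scalars) are used as they are. The fields
  \<open>mult\<close> and \<open>one\<close> which the record inherits from rings are never looked at for a module.
\<close>

locale left_module = R?: ring R + M?: abelian_group M for R (structure) and M (structure) +
  assumes smult_closed [simp, intro]:
      "\<lbrakk>a \<in> carrier R; x \<in> carrier M\<rbrakk> \<Longrightarrow> a \<odot>\<^bsub>M\<^esub> x \<in> carrier M"
    and smult_l_distr:
      "\<lbrakk>a \<in> carrier R; b \<in> carrier R; x \<in> carrier M\<rbrakk> \<Longrightarrow>
        (a \<oplus> b) \<odot>\<^bsub>M\<^esub> x = a \<odot>\<^bsub>M\<^esub> x \<oplus>\<^bsub>M\<^esub> b \<odot>\<^bsub>M\<^esub> x"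
    and smult_r_distr:
      "\<lbrakk>a \<in> carrier R; x \<in> carrier M; y \<in> carrier M\<rbrakk> \<Longrightarrow>
        a \<odot>\<^bsub>M\<^esub> (x \<oplus>\<^bsub>M\<^esub> y) = a \<odot>\<^bsub>M\<^esub> x \<oplus>\<^bsub>M\<^esub> a \<odot>\<^bsub>M\<^esub> y"
    and smult_assoc1:
      "\<lbrakk>a \<in> carrier R; b \<in> carrier R; x \<in> carrier M\<rbrakk> \<Longrightarrow>
        (a \<otimes> b) \<odot>\<^bsub>M\<^esub> x = a \<odot>\<^bsub>M\<^esub> (b \<odot>\<^bsub>M\<^esub> x)"
    and smult_one [simp]:
      "x \<in> carrier M \<Longrightarrow> \<one> \<odot>\<^bsub>M\<^esub> x = x"

definition gen_submodule :: "('r, 'a) ring_scheme \<Rightarrow> ('r, 'm, 'b) module_scheme \<Rightarrow> 'm set \<Rightarrow> 'm set"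
  where "gen_submodule R M S = \<Inter>{N. submodule N R M \<and> S \<subseteq> N}"

definition regular_module :: "('r, 'a) ring_scheme \<Rightarrow> ('r, 'r) module"
  where "regular_module R =
    \<lparr>carrier = carrier R, mult = mult R, one = \<one>\<^bsub>R\<^esub>, zero = \<zero>\<^bsub>R\<^esub>, add = add R,
     smult = mult R\<rparr>"

definition gen_left_ideal :: "('r, 'a) ring_scheme \<Rightarrow> 'r set \<Rightarrow> 'r set"
  where "gen_left_ideal R S = gen_submodule R (regular_module R) S"

definition quotient_module :: "('r, 'm, 'b) module_scheme \<Rightarrow> 'm set \<Rightarrow> ('r, 'm set) module"
  where "quotient_module M N =
    \<lparr>carrier = a_rcosets\<^bsub>M\<^esub> N, mult = undefined, one = undefined, zero = N, add = set_add M,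
     smult = (\<lambda>a X. \<Union>x\<in>X. N +>\<^bsub>M\<^esub> (a \<odot>\<^bsub>M\<^esub> x))\<rparr>"

definition left_module_iso ::
    "('r, 'a) ring_scheme \<Rightarrow> ('r, 'm, 'b) module_scheme \<Rightarrow> ('r, 'k, 'c) module_scheme \<Rightarrow> ('m \<Rightarrow> 'k) set"
  where "left_module_iso R M N =
    {f. bij_betw f (carrier M) (carrier N) \<and>
        (\<forall>x\<in>carrier M. \<forall>y\<in>carrier M. f (x \<oplus>\<^bsub>M\<^esub> y) = f x \<oplus>\<^bsub>N\<^esub> f y) \<and>
        (\<forall>a\<in>carrier R. \<forall>x\<in>carrier M. f (a \<odot>\<^bsub>M\<^esub> x) = a \<odot>\<^bsub>N\<^esub> f x)}"

definition left_module_isomorphic ::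
    "('r, 'a) ring_scheme \<Rightarrow> ('r, 'm, 'b) module_scheme \<Rightarrow> ('r, 'k, 'c) module_scheme \<Rightarrow> bool"
  where "left_module_isomorphic R M N \<longleftrightarrow> left_module_iso R M N \<noteq> {}"


section \<open>The free algebra on the generators\<close>

type_synonym qv = "rat poly fract"

definition v :: qv
  where "v = Fraction_Field.Fract [:0, 1:] 1"

text \<open>
  The free monoid is written additively, because the convolution product of
  \<open>Poly_Mapping\<close> is built from the addition of the index type.
  Thus \<open>0\<close> is the empty word, \<open>+\<close> is concatenation, and \<open>'g fword \<Rightarrow>\<^sub>0 'k\<close> is
  the free \<open>'k\<close>-algebra on the set of all letters of type \<open>'g\<close>.
\<close>

datatype 'g fword = FWord (letters: "'g list")

instantiation fword :: (type) monoid_add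
begin

definition zero_fword :: "'a fword"
  where "zero_fword = FWord []"

definition plus_fword :: "'a fword \<Rightarrow> 'a fword \<Rightarrow> 'a fword"
  where "plus_fword x y = FWord (letters x @ letters y)"

instance
  by standard (simp_all add: zero_fword_def plus_fword_def)

end

text \<open>\<open>gKi i\<close> is the formal inverse of \<open>gK i\<close>; the suffix \<open>b\<close> stands for a barred (odd) generator.\<close>

datatype qq_gen = gK nat | gKi nat | gE nat | gF nat | gKb nat | gEb nat | gFb nat

type_synonym qq_poly = "qq_gen fword \<Rightarrow>\<^sub>0 qv"

definition qq_gens :: "nat \<Rightarrow> qq_gen set"
  where "qq_gens n =
    gK ` {1..n} \<union> gKi ` {1..n} \<union> gKb ` {1..n} \<union>
    gE ` {1..n-1} \<union> gF ` {1..n-1} \<union> gEb ` {1..n-1} \<union> gFb ` {1..n-1}"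

definition qq_free :: "nat \<Rightarrow> qq_poly ring"
  where "qq_free n =
    \<lparr>carrier = {p. \<forall>w\<in>Poly_Mapping.keys p. set (letters w) \<subseteq> qq_gens n},
     mult = (*), one = 1, zero = 0, add = (+)\<rparr>"

definition sc :: "qv \<Rightarrow> qq_poly"
  where "sc c = Poly_Mapping.single 0 c"

definition letter :: "qq_gen \<Rightarrow> qq_poly"
  where "letter g = Poly_Mapping.single (FWord [g]) 1"

abbreviation "fK i \<equiv> letter (gK i)"
abbreviation "fKi i \<equiv> letter (gKi i)"
abbreviation "fE j \<equiv> letter (gE j)"
abbreviation "fF j \<equiv> letter (gF j)"
abbreviation "fKb i \<equiv> letter (gKb i)"
abbreviation "fEb j \<equiv> letter (gEb j)"
abbreviation "fFb j \<equiv> letter (gFb j)"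


section \<open>The quantum queer superalgebra\<close>

text \<open>Weights are integer vectors in coordinates with respect to \<open>\<epsilon>\<^sub>1, \<dots>, \<epsilon>\<^sub>n\<close>.\<close>

definition eps :: "nat \<Rightarrow> nat \<Rightarrow> int"
  where "eps i = (\<lambda>k. of_bool (k = i))"

definition alpha :: "nat \<Rightarrow> nat \<Rightarrow> int"
  where "alpha j = (\<lambda>k. eps j k - eps (j + 1) k)"

definition pairing :: "nat \<Rightarrow> (nat \<Rightarrow> int) \<Rightarrow> (nat \<Rightarrow> int) \<Rightarrow> int"
  where "pairing n x y = (\<Sum>k=1..n. x k * y k)"

definition delta :: "nat \<Rightarrow> nat \<Rightarrow> qv"
  where "delta i j = of_bool (i = j)"

text \<open>
  \<open>qq_rel n a b\<close>: the equation \<open>a = b\<close> is one of the defining relations. The index bounds are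
  \<open>{1..n}\<close> for \<open>K\<close>, \<open>Ki\<close>, \<open>Kb\<close> and \<open>{1..n-1}\<close> for the other generators. Where \<open>i-1\<close> occurs as an
  index, \<open>i-1\<close> ranges over \<open>{1..n-1}\<close>, so the truncated subtraction is harmless.
\<close>

inductive qq_rel :: "nat \<Rightarrow> qq_poly \<Rightarrow> qq_poly \<Rightarrow> bool" for n :: nat where
  "i \<in> {1..n} \<Longrightarrow> qq_rel n (fK i * fKi i) 1"
| "i \<in> {1..n} \<Longrightarrow> qq_rel n (fKi i * fK i) 1"
| "i \<in> {1..n} \<Longrightarrow> j \<in> {1..n} \<Longrightarrow> qq_rel n (fK i * fK j) (fK j * fK i)"
| "i \<in> {1..n} \<Longrightarrow> j \<in> {1..n} \<Longrightarrow> qq_rel n (fK i * fKb j) (fKb j * fK i)"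
| "i \<in> {1..n} \<Longrightarrow> j \<in> {1..n} \<Longrightarrow>
    qq_rel n (fKb i * fKb j + fKb j * fKb i)
      (sc (2 * delta i j / (v powi 2 - v powi (-2))) * (fK i ^ 2 - fKi i ^ 2))"
| "i \<in> {1..n} \<Longrightarrow> j \<in> {1..n-1} \<Longrightarrow> X \<in> {fE j, fEb j} \<Longrightarrow>
    qq_rel n (fK i * X) (sc (v powi pairing n (eps i) (alpha j)) * X * fK i)"
| "i \<in> {1..n} \<Longrightarrow> j \<in> {1..n-1} \<Longrightarrow> X \<in> {fF j, fFb j} \<Longrightarrow>
    qq_rel n (fK i * X) (sc (v powi (- pairing n (eps i) (alpha j))) * X * fK i)"
| "i \<in> {1..n-1} \<Longrightarrow> qq_rel n (fKb i * fE i - sc v * fE i * fKb i) (fEb i * fKi i)"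
| "i \<in> {2..n} \<Longrightarrow> qq_rel n (sc v * fKb i * fE (i-1) - fE (i-1) * fKb i) (- (fKi i * fEb (i-1)))"
| "i \<in> {1..n-1} \<Longrightarrow> qq_rel n (fKb i * fF i - sc v * fF i * fKb i) (- (fFb i * fK i))"
| "i \<in> {2..n} \<Longrightarrow> qq_rel n (sc v * fKb i * fF (i-1) - fF (i-1) * fKb i) (fK i * fFb (i-1))"
| "i \<in> {1..n-1} \<Longrightarrow> qq_rel n (fKb i * fEb i + sc v * fEb i * fKb i) (fE i * fKi i)"
| "i \<in> {2..n} \<Longrightarrow> qq_rel n (sc v * fKb i * fEb (i-1) + fEb (i-1) * fKb i) (fKi i * fE (i-1))"
| "i \<in> {1..n-1} \<Longrightarrow> qq_rel n (fKb i * fFb i + sc v * fFb i * fKb i) (fF i * fK i)"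
| "i \<in> {2..n} \<Longrightarrow> qq_rel n (sc v * fKb i * fFb (i-1) + fFb (i-1) * fKb i) (fK i * fF (i-1))"
| "i \<in> {1..n} \<Longrightarrow> j \<in> {1..n-1} \<Longrightarrow> j \<noteq> i \<Longrightarrow> j \<noteq> i-1 \<Longrightarrow> qq_rel n (fKb i * fE j - fE j * fKb i) 0"
| "i \<in> {1..n} \<Longrightarrow> j \<in> {1..n-1} \<Longrightarrow> j \<noteq> i \<Longrightarrow> j \<noteq> i-1 \<Longrightarrow> qq_rel n (fKb i * fF j - fF j * fKb i) 0"
| "i \<in> {1..n} \<Longrightarrow> j \<in> {1..n-1} \<Longrightarrow> j \<noteq> i \<Longrightarrow> j \<noteq> i-1 \<Longrightarrow> qq_rel n (fKb i * fEb j + fEb j * fKb i) 0"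
| "i \<in> {1..n} \<Longrightarrow> j \<in> {1..n-1} \<Longrightarrow> j \<noteq> i \<Longrightarrow> j \<noteq> i-1 \<Longrightarrow> qq_rel n (fKb i * fFb j + fFb j * fKb i) 0"
| "i \<in> {1..n-1} \<Longrightarrow> j \<in> {1..n-1} \<Longrightarrow>
    qq_rel n (fE i * fF j - fF j * fE i)
      (sc (delta i j / (v - inverse v)) * (fK i * fKi (i+1) - fKi i * fK (i+1)))"
| "i \<in> {1..n-1} \<Longrightarrow> j \<in> {1..n-1} \<Longrightarrow>
    qq_rel n (fEb i * fFb j + fFb j * fEb i)
      (sc (delta i j) * (sc (1 / (v - inverse v)) * (fK i * fK (i+1) - fKi i * fKi (i+1))
                         + sc (v - inverse v) * fKb i * fKb (i+1)))"
| "i \<in> {1..n-1} \<Longrightarrow> j \<in> {1..n-1} \<Longrightarrow>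
    qq_rel n (fE i * fFb j - fFb j * fE i)
      (sc (delta i j) * (fKi (i+1) * fKb i - fKb (i+1) * fKi i))"
| "i \<in> {1..n-1} \<Longrightarrow> j \<in> {1..n-1} \<Longrightarrow>
    qq_rel n (fEb i * fF j - fF j * fEb i)
      (sc (delta i j) * (fK (i+1) * fKb i - fKb (i+1) * fK i))"
| "i \<in> {1..n-1} \<Longrightarrow> qq_rel n (fEb i ^ 2) (sc (- ((v - inverse v) / (v + inverse v))) * fE i ^ 2)"
| "i \<in> {1..n-1} \<Longrightarrow> qq_rel n (fFb i ^ 2) (sc ((v - inverse v) / (v + inverse v)) * fF i ^ 2)"
| "i \<in> {1..n-1} \<Longrightarrow> j \<in> {1..n-1} \<Longrightarrow> \<bar>int i - int j\<bar> \<noteq> 1 \<Longrightarrow> qq_rel n (fE i * fEb j) (fEb j * fE i)"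
| "i \<in> {1..n-1} \<Longrightarrow> j \<in> {1..n-1} \<Longrightarrow> \<bar>int i - int j\<bar> \<noteq> 1 \<Longrightarrow> qq_rel n (fF i * fFb j) (fFb j * fF i)"
| "i \<in> {1..n-1} \<Longrightarrow> j \<in> {1..n-1} \<Longrightarrow> \<bar>int i - int j\<bar> > 1 \<Longrightarrow> qq_rel n (fE i * fE j) (fE j * fE i)"
| "i \<in> {1..n-1} \<Longrightarrow> j \<in> {1..n-1} \<Longrightarrow> \<bar>int i - int j\<bar> > 1 \<Longrightarrow> qq_rel n (fF i * fF j) (fF j * fF i)"
| "i \<in> {1..n-1} \<Longrightarrow> j \<in> {1..n-1} \<Longrightarrow> \<bar>int i - int j\<bar> > 1 \<Longrightarrow> qq_rel n (fEb i * fEb j) (- (fEb j * fEb i))"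
| "i \<in> {1..n-1} \<Longrightarrow> j \<in> {1..n-1} \<Longrightarrow> \<bar>int i - int j\<bar> > 1 \<Longrightarrow> qq_rel n (fFb i * fFb j) (- (fFb j * fFb i))"
| "i \<in> {1..n-1} \<Longrightarrow> i+1 \<in> {1..n-1} \<Longrightarrow>
    qq_rel n (fE i * fE (i+1) - sc v * fE (i+1) * fE i) (fEb i * fEb (i+1) + sc v * fEb (i+1) * fEb i)"
| "i \<in> {1..n-1} \<Longrightarrow> i+1 \<in> {1..n-1} \<Longrightarrow>
    qq_rel n (fE i * fEb (i+1) - sc v * fEb (i+1) * fE i) (fEb i * fE (i+1) - sc v * fE (i+1) * fEb i)"
| "i \<in> {1..n-1} \<Longrightarrow> i+1 \<in> {1..n-1} \<Longrightarrow>
    qq_rel n (fF i * fF (i+1) - sc v * fF (i+1) * fF i) (- (fFb i * fFb (i+1) + sc v * fFb (i+1) * fFb i))"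
| "i \<in> {1..n-1} \<Longrightarrow> i+1 \<in> {1..n-1} \<Longrightarrow>
    qq_rel n (fF i * fFb (i+1) - sc v * fFb (i+1) * fF i) (fFb i * fF (i+1) - sc v * fF (i+1) * fFb i)"
| "i \<in> {1..n-1} \<Longrightarrow> j \<in> {1..n-1} \<Longrightarrow> \<bar>int i - int j\<bar> = 1 \<Longrightarrow> X \<in> {fE j, fEb j} \<Longrightarrow>
    qq_rel n (fE i ^ 2 * X - sc (v + inverse v) * fE i * X * fE i + X * fE i ^ 2) 0"
| "i \<in> {1..n-1} \<Longrightarrow> j \<in> {1..n-1} \<Longrightarrow> \<bar>int i - int j\<bar> = 1 \<Longrightarrow> Y \<in> {fF j, fFb j} \<Longrightarrow>
    qq_rel n (fF i ^ 2 * Y - sc (v + inverse v) * fF i * Y * fF i + Y * fF i ^ 2) 0"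

definition qq_ideal :: "nat \<Rightarrow> qq_poly set"
  where "qq_ideal n = Idl\<^bsub>qq_free n\<^esub> {a - b | a b. qq_rel n a b}"

definition qq_U :: "nat \<Rightarrow> qq_poly set ring"
  where "qq_U n = qq_free n Quot qq_ideal n"

definition qq_class :: "nat \<Rightarrow> qq_poly \<Rightarrow> qq_poly set"
  where "qq_class n p = qq_ideal n +>\<^bsub>qq_free n\<^esub> p"

text \<open>
  The images in \<open>U\<^sub>v\<close> of the generators and of the scalars \<open>c \<cdot> 1\<close>. Through the latter every
  \<open>U\<^sub>v\<close>-module is a vector space over the ground field.
\<close>

abbreviation "uK n i \<equiv> qq_class n (fK i)"
abbreviation "uE n j \<equiv> qq_class n (fE j)"
abbreviation "uEb n j \<equiv> qq_class n (fEb j)"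
abbreviation "uscal n c \<equiv> qq_class n (sc c)"

primrec odd_gen :: "qq_gen \<Rightarrow> bool" where
  "odd_gen (gK i) = False"
| "odd_gen (gKi i) = False"
| "odd_gen (gE j) = False"
| "odd_gen (gF j) = False"
| "odd_gen (gKb i) = True"
| "odd_gen (gEb j) = True"
| "odd_gen (gFb j) = True"

text \<open>
  The even (\<open>d = False\<close>) and odd (\<open>d = True\<close>) parts of the superalgebra \<open>U\<^sub>v\<close>. Modules are plain
  left modules, without a grading, so that the parts do not enter the definitions below.
\<close>

definition qq_part :: "nat \<Rightarrow> bool \<Rightarrow> qq_poly set set"
  where "qq_part n d = qq_class n `
    {p \<in> carrier (qq_free n). \<forall>w\<in>Poly_Mapping.keys p. odd (length (filter odd_gen (letters w))) = d}"


section \<open>Highest weight modules and Verma modules\<close>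

text \<open>Elements of \<open>P\<^sup>n\<close> are functions on \<open>nat\<close> whose values outside \<open>{1..n}\<close> are irrelevant.\<close>

definition weights_P :: "nat \<Rightarrow> (nat \<Rightarrow> qv) set"
  where "weights_P n = {1..n} \<rightarrow> UNIV - {0}"

definition weight_space :: "nat \<Rightarrow> (qq_poly set, 'm) module \<Rightarrow> (nat \<Rightarrow> qv) \<Rightarrow> 'm set"
  where "weight_space n M \<omega> =
    {m \<in> carrier M. \<forall>i\<in>{1..n}. uK n i \<odot>\<^bsub>M\<^esub> m = uscal n (\<omega> i) \<odot>\<^bsub>M\<^esub> m}"

definition highest_weight_vector :: "nat \<Rightarrow> (qq_poly set, 'm) module \<Rightarrow> (nat \<Rightarrow> qv) \<Rightarrow> 'm \<Rightarrow> bool"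
  where "highest_weight_vector n M \<omega> m \<longleftrightarrow>
    m \<in> weight_space n M \<omega> \<and> m \<noteq> \<zero>\<^bsub>M\<^esub> \<and>
    (\<forall>j\<in>{1..n-1}. uE n j \<odot>\<^bsub>M\<^esub> m = \<zero>\<^bsub>M\<^esub> \<and> uEb n j \<odot>\<^bsub>M\<^esub> m = \<zero>\<^bsub>M\<^esub>)"

definition highest_weight_module :: "nat \<Rightarrow> (nat \<Rightarrow> qv) \<Rightarrow> (qq_poly set, 'm) module \<Rightarrow> bool"
  where "highest_weight_module n \<omega> M \<longleftrightarrow>
    left_module (qq_U n) M \<and>
    (\<exists>m. highest_weight_vector n M \<omega> m \<and> gen_submodule (qq_U n) M {m} = carrier M)"

definition verma_ideal :: "nat \<Rightarrow> (nat \<Rightarrow> qv) \<Rightarrow> qq_poly set set"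
  where "verma_ideal n \<omega> = gen_left_ideal (qq_U n)
    ({uK n i \<ominus>\<^bsub>qq_U n\<^esub> uscal n (\<omega> i) | i. i \<in> {1..n}} \<union>
     {uE n j | j. j \<in> {1..n-1}} \<union> {uEb n j | j. j \<in> {1..n-1}})"

definition verma :: "nat \<Rightarrow> (nat \<Rightarrow> qv) \<Rightarrow> (qq_poly set, qq_poly set set) module"
  where "verma n \<omega> = quotient_module (regular_module (qq_U n)) (verma_ideal n \<omega>)"

end

theory Submission
  imports Defs
begin

text \<open>
  A highest weight module is cyclic: if \<open>m\<close> is a generating highest weight vector of \<open>M\<close>, then the
  orbit map \<open>a \<mapsto> a m\<close> is a homomorphism from the regular module \<open>U\<^sub>v\<close> onto \<open>M\<close>, because its
  image is a submodule that contains \<open>m\<close> (\<open>orbit_map_surj\<close>). The weight and vanishing conditions on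
  a highest weight vector say exactly that this map kills the generators of \<open>I(\<omega>)\<close>; since the
  annihilator of \<open>m\<close> is a left ideal, the map kills all of \<open>I(\<omega>)\<close>
  (\<open>verma_ideal_annihilates\<close>). So it factors through a
  homomorphism from \<open>V(\<omega>)\<close> onto \<open>M\<close> (\<open>quotient_lift_hom\<close>), and the first isomorphism theorem
  (\<open>first_isomorphism\<close>) exhibits \<open>M\<close> as the quotient of \<open>V(\<omega>)\<close> by the kernel.
\<close>

section \<open>Submodules and quotients of left modules\<close>

context left_module
begin

lemma smult_zero_right:
  assumes "a \<in> carrier R"
  shows "a \<odot>\<^bsub>M\<^esub> \<zero>\<^bsub>M\<^esub> = \<zero>\<^bsub>M\<^esub>"
proof -
  have "a \<odot>\<^bsub>M\<^esub> \<zero>\<^bsub>M\<^esub> \<oplus>\<^bsub>M\<^esub> a \<odot>\<^bsub>M\<^esub> \<zero>\<^bsub>M\<^esub> = a \<odot>\<^bsub>M\<^esub> \<zero>\<^bsub>M\<^esub>"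
    using assms by (simp flip: smult_r_distr)
  then show ?thesis
    using assms by (metis M.add.l_cancel_one M.zero_closed smult_closed)
qed

lemma smult_zero_left:
  assumes "x \<in> carrier M"
  shows "\<zero>\<^bsub>R\<^esub> \<odot>\<^bsub>M\<^esub> x = \<zero>\<^bsub>M\<^esub>"
proof -
  have "\<zero>\<^bsub>R\<^esub> \<odot>\<^bsub>M\<^esub> x \<oplus>\<^bsub>M\<^esub> \<zero>\<^bsub>R\<^esub> \<odot>\<^bsub>M\<^esub> x = \<zero>\<^bsub>R\<^esub> \<odot>\<^bsub>M\<^esub> x"
    using assms by (simp flip: smult_l_distr)
  then show ?thesis
    using assms by (metis M.add.l_cancel_one R.zero_closed smult_closed)
qed

lemma smult_minus_left:
  assumes "a \<in> carrier R" "x \<in> carrier M"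
  shows "(\<ominus>\<^bsub>R\<^esub> a) \<odot>\<^bsub>M\<^esub> x = \<ominus>\<^bsub>M\<^esub> (a \<odot>\<^bsub>M\<^esub> x)"
proof -
  have "(\<ominus>\<^bsub>R\<^esub> a) \<odot>\<^bsub>M\<^esub> x \<oplus>\<^bsub>M\<^esub> a \<odot>\<^bsub>M\<^esub> x = \<zero>\<^bsub>M\<^esub>"
    using assms by (simp add: R.l_neg smult_zero_left flip: smult_l_distr)
  then show ?thesis
    using assms by (simp add: M.minus_equality)
qed

text \<open>
  Closure under negation need not be checked separately, because \<open>- x\<close> is the scalar multiple
  \<open>(- 1) x\<close>.
\<close>

lemma left_submoduleI:
  assumes "H \<subseteq> carrier M" "\<zero>\<^bsub>M\<^esub> \<in> H"
    and "\<And>x y. x \<in> H \<Longrightarrow> y \<in> H \<Longrightarrow> x \<oplus>\<^bsub>M\<^esub> y \<in> H"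
    and smult: "\<And>a x. a \<in> carrier R \<Longrightarrow> x \<in> H \<Longrightarrow> a \<odot>\<^bsub>M\<^esub> x \<in> H"
  shows "submodule H R M"
proof -
  have neg: "\<ominus>\<^bsub>M\<^esub> x \<in> H" if "x \<in> H" for x
  proof -
    have "x \<in> carrier M"
      using assms(1) that by auto
    then have "\<ominus>\<^bsub>M\<^esub> x = (\<ominus>\<^bsub>R\<^esub> \<one>\<^bsub>R\<^esub>) \<odot>\<^bsub>M\<^esub> x"
      by (simp add: smult_minus_left)
    then show ?thesis
      using smult that by simp
  qed
  have "subgroup H (add_monoid M)"
    using assms neg by (intro subgroup.intro) (auto simp flip: a_inv_def)
  then show ?thesis
    using smult by (simp add: submodule_def submodule_axioms_def)
qed

lemma gen_submodule_least:
  assumes "submodule H R M" "S \<subseteq> H"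
  shows "gen_submodule R M S \<subseteq> H"
  using assms unfolding gen_submodule_def by blast

lemma carrier_submodule: "submodule (carrier M) R M"
  by (rule left_submoduleI) auto

lemma gen_submodule_submodule:
  assumes "S \<subseteq> carrier M"
  shows "submodule (gen_submodule R M S) R M"
proof -
  let ?F = "{N. submodule N R M \<and> S \<subseteq> N}"
  have "carrier M \<in> ?F"
    using assms carrier_submodule by simp
  then have "subgroup (\<Inter>?F) (add_monoid M)"
    by (intro M.add.subgroups_Inter) (auto simp: submodule_def)
  then show ?thesis
    by (auto simp: gen_submodule_def submodule_def submodule_axioms_def)
qed

lemma submodule_abelian_subgroup:
  assumes "submodule N R M"
  shows "abelian_subgroup N M"
  using assms M.abelian_group_axioms
  by (intro abelian_subgroupI3 additive_subgroup.intro) (auto simp: submodule_def)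

lemma quotient_carrier:
  "carrier (quotient_module M N) = (\<lambda>x. N +>\<^bsub>M\<^esub> x) ` carrier M"
  by (auto simp: quotient_module_def A_RCOSETS_def')

lemma quotient_zero:
  assumes "submodule N R M"
  shows "\<zero>\<^bsub>quotient_module M N\<^esub> = N +>\<^bsub>M\<^esub> \<zero>\<^bsub>M\<^esub>"
proof -
  interpret N: abelian_subgroup N M
    by (rule submodule_abelian_subgroup) fact
  show ?thesis
    using N.a_subset by (simp add: quotient_module_def)
qed

lemma quotient_add:
  assumes "submodule N R M" "x \<in> carrier M" "y \<in> carrier M"
  shows "(N +>\<^bsub>M\<^esub> x) \<oplus>\<^bsub>quotient_module M N\<^esub> (N +>\<^bsub>M\<^esub> y) = N +>\<^bsub>M\<^esub> (x \<oplus>\<^bsub>M\<^esub> y)"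
proof -
  interpret N: abelian_subgroup N M
    by (rule submodule_abelian_subgroup) fact
  show ?thesis
    using assms by (simp add: quotient_module_def N.a_rcos_sum)
qed

text \<open>
  The union in the definition of scalar multiplication on a quotient is over equal sets: two
  representatives differ by an element of the submodule, which is stable under scalars.
\<close>

lemma quotient_smult:
  assumes N: "submodule N R M" and a: "a \<in> carrier R" and x: "x \<in> carrier M"
  shows "a \<odot>\<^bsub>quotient_module M N\<^esub> (N +>\<^bsub>M\<^esub> x) = N +>\<^bsub>M\<^esub> (a \<odot>\<^bsub>M\<^esub> x)"
proof -
  interpret N: abelian_subgroup N M
    by (rule submodule_abelian_subgroup) fact
  have "N +>\<^bsub>M\<^esub> (a \<odot>\<^bsub>M\<^esub> y) = N +>\<^bsub>M\<^esub> (a \<odot>\<^bsub>M\<^esub> x)" if y: "y \<in> N +>\<^bsub>M\<^esub> x" for y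
  proof -
    obtain h where h: "h \<in> N" "y = h \<oplus>\<^bsub>M\<^esub> x"
      using y by (auto simp: a_r_coset_def')
    then have "a \<odot>\<^bsub>M\<^esub> y = a \<odot>\<^bsub>M\<^esub> h \<oplus>\<^bsub>M\<^esub> a \<odot>\<^bsub>M\<^esub> x"
      using a x by (simp add: smult_r_distr)
    moreover have "a \<odot>\<^bsub>M\<^esub> h \<in> N"
      using N a h(1) by (rule submodule.smult_closed)
    ultimately have "a \<odot>\<^bsub>M\<^esub> y \<in> N +>\<^bsub>M\<^esub> (a \<odot>\<^bsub>M\<^esub> x)"
      by (auto simp: a_r_coset_def')
    then show ?thesis
      using a x by (intro N.a_repr_independence'[symmetric]) auto
  qed
  moreover have "x \<in> N +>\<^bsub>M\<^esub> x"
    using x by (rule N.a_rcos_self)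
  ultimately have "(\<Union>y\<in>N +>\<^bsub>M\<^esub> x. N +>\<^bsub>M\<^esub> (a \<odot>\<^bsub>M\<^esub> y)) = N +>\<^bsub>M\<^esub> (a \<odot>\<^bsub>M\<^esub> x)"
    by blast
  then show ?thesis
    by (simp add: quotient_module_def)
qed

lemma quotient_left_module:
  assumes N: "submodule N R M"
  shows "left_module R (quotient_module M N)"
proof -
  have "abelian_group (quotient_module M N)"
  proof (rule abelian_groupI)
    fix X assume "X \<in> carrier (quotient_module M N)"
    then obtain x where x: "x \<in> carrier M" "X = N +>\<^bsub>M\<^esub> x"
      by (auto simp: quotient_carrier)
    then have "(N +>\<^bsub>M\<^esub> \<ominus>\<^bsub>M\<^esub> x) \<oplus>\<^bsub>quotient_module M N\<^esub> X = \<zero>\<^bsub>quotient_module M N\<^esub>"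
      by (simp add: quotient_zero[OF N] quotient_add[OF N] M.l_neg)
    then show "\<exists>Y\<in>carrier (quotient_module M N).
        Y \<oplus>\<^bsub>quotient_module M N\<^esub> X = \<zero>\<^bsub>quotient_module M N\<^esub>"
      using x(1) by (auto simp: quotient_carrier)
  qed (auto simp: quotient_carrier quotient_zero[OF N] quotient_add[OF N] M.a_ac)
  then show ?thesis
    by (intro left_module.intro R.ring_axioms left_module_axioms.intro)
      (auto simp: quotient_carrier quotient_add[OF N] quotient_smult[OF N]
        smult_l_distr smult_r_distr smult_assoc1)
qed

end

section \<open>Homomorphisms of left modules\<close>

locale left_module_hom = A?: left_module R A + B?: left_module R B
  for R (structure) and A (structure) and B (structure) +
  fixes f
  assumes hom_closed: "x \<in> carrier A \<Longrightarrow> f x \<in> carrier B"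
    and hom_add: "x \<in> carrier A \<Longrightarrow> y \<in> carrier A \<Longrightarrow> f (x \<oplus>\<^bsub>A\<^esub> y) = f x \<oplus>\<^bsub>B\<^esub> f y"
    and hom_smult: "a \<in> carrier R \<Longrightarrow> x \<in> carrier A \<Longrightarrow> f (a \<odot>\<^bsub>A\<^esub> x) = a \<odot>\<^bsub>B\<^esub> f x"
begin

definition ker :: "_ set"
  where "ker = {x \<in> carrier A. f x = \<zero>\<^bsub>B\<^esub>}"

lemma hom_zero: "f \<zero>\<^bsub>A\<^esub> = \<zero>\<^bsub>B\<^esub>"
  using hom_smult[of "\<zero>\<^bsub>R\<^esub>" "\<zero>\<^bsub>A\<^esub>"] hom_closed
  by (simp add: A.smult_zero_left B.smult_zero_left)

lemma ker_submodule: "submodule ker R A"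
  by (rule A.left_submoduleI)
    (auto simp: ker_def hom_zero hom_add hom_smult B.smult_zero_right)

lemma image_submodule: "submodule (f ` carrier A) R B"
proof (rule B.left_submoduleI)
  show "\<zero>\<^bsub>B\<^esub> \<in> f ` carrier A"
    by (metis A.M.zero_closed hom_zero image_eqI)
qed (auto simp: hom_closed simp flip: hom_add hom_smult)

lemma ker_coset_eq_fibre:
  assumes x: "x \<in> carrier A"
  shows "ker +>\<^bsub>A\<^esub> x = {y \<in> carrier A. f y = f x}"
proof (intro equalityI subsetI)
  fix y assume "y \<in> ker +>\<^bsub>A\<^esub> x"
  then show "y \<in> {y \<in> carrier A. f y = f x}"
    using x by (auto simp: a_r_coset_def' ker_def hom_add hom_closed)
next
  fix y assume y: "y \<in> {y \<in> carrier A. f y = f x}"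
  let ?d = "y \<oplus>\<^bsub>A\<^esub> \<ominus>\<^bsub>A\<^esub> x"
  have d: "?d \<in> carrier A" "?d \<oplus>\<^bsub>A\<^esub> x = y"
    using x y by (auto simp: A.M.a_assoc A.M.l_neg)
  then have "f ?d \<oplus>\<^bsub>B\<^esub> f x = \<zero>\<^bsub>B\<^esub> \<oplus>\<^bsub>B\<^esub> f x"
    using x y hom_closed by (simp flip: hom_add)
  then have "f ?d = \<zero>\<^bsub>B\<^esub>"
    using d(1) x hom_closed by (metis B.M.add.right_cancel B.M.zero_closed)
  then show "y \<in> ker +>\<^bsub>A\<^esub> x"
    using d by (auto simp: a_r_coset_def' ker_def intro!: bexI[of _ ?d])
qed

text \<open>
  The isomorphism sends an element of the target to its fibre. The fibres are the cosets of the
  kernel, so this map, unlike one in the other direction, needs no choice of representatives.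
\<close>

lemma first_isomorphism:
  assumes surj: "f ` carrier A = carrier B"
  shows "left_module_isomorphic R B (quotient_module A ker)"
proof -
  let ?g = "\<lambda>b. {x \<in> carrier A. f x = b}"
  let ?Q = "quotient_module A ker"
  have g: "?g (f x) = ker +>\<^bsub>A\<^esub> x" if "x \<in> carrier A" for x
    using ker_coset_eq_fibre[OF that] by simp
  have preimage: "\<exists>x\<in>carrier A. b = f x" if "b \<in> carrier B" for b
    using that surj by (metis imageE)
  have "inj_on ?g (carrier B)"
  proof (rule inj_onI)
    fix b c assume "b \<in> carrier B" and eq: "?g b = ?g c"
    then obtain x where "x \<in> carrier A" "b = f x"
      using preimage by blast
    then have "x \<in> ?g c"
      by (simp flip: eq)
    then show "b = c"
      using \<open>b = f x\<close> by simp
  qed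
  moreover have "?g ` carrier B = carrier ?Q"
  proof -
    have "?g ` carrier B = (\<lambda>x. ?g (f x)) ` carrier A"
      by (simp only: image_image flip: surj)
    also have "\<dots> = (\<lambda>x. ker +>\<^bsub>A\<^esub> x) ` carrier A"
      by (rule image_cong[OF refl g])
    finally show ?thesis
      by (simp only: A.quotient_carrier)
  qed
  moreover have "?g (b \<oplus>\<^bsub>B\<^esub> c) = ?g b \<oplus>\<^bsub>?Q\<^esub> ?g c" if b: "b \<in> carrier B" and c: "c \<in> carrier B" for b c
  proof -
    obtain x y where "x \<in> carrier A" "y \<in> carrier A" and bc: "b = f x" "c = f y"
      using preimage[OF b] preimage[OF c] by blast
    then show ?thesis
      unfolding bc by (simp only: g A.quotient_add[OF ker_submodule] A.M.a_closed flip: hom_add)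
  qed
  moreover have "?g (a \<odot>\<^bsub>B\<^esub> b) = a \<odot>\<^bsub>?Q\<^esub> ?g b" if "a \<in> carrier R" "b \<in> carrier B" for a b
  proof -
    obtain x where "x \<in> carrier A" and b: "b = f x"
      using preimage[OF \<open>b \<in> carrier B\<close>] by blast
    then show ?thesis
      using \<open>a \<in> carrier R\<close> unfolding b
      by (simp only: g A.quotient_smult[OF ker_submodule] A.smult_closed flip: hom_smult)
  qed
  ultimately have "?g \<in> left_module_iso R B ?Q"
    by (simp add: left_module_iso_def bij_betw_def)
  then show ?thesis
    by (auto simp: left_module_isomorphic_def)
qed

definition quotient_lift
  where "quotient_lift X = the_elem (f ` X)"

text \<open>
  The lift is computed on any representative, because the homomorphism is constant on the cosets
  of a submodule of its kernel.
\<close>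

lemma quotient_lift_coset:
  assumes N: "submodule N R A" "N \<subseteq> ker" and x: "x \<in> carrier A"
  shows "quotient_lift (N +>\<^bsub>A\<^esub> x) = f x"
proof -
  have "N +>\<^bsub>A\<^esub> x \<subseteq> ker +>\<^bsub>A\<^esub> x"
    using N(2) by (auto simp: a_r_coset_def')
  then have "f ` (N +>\<^bsub>A\<^esub> x) \<subseteq> {f x}"
    using ker_coset_eq_fibre[OF x] by auto
  moreover have "x \<in> N +>\<^bsub>A\<^esub> x"
    using A.submodule_abelian_subgroup[OF N(1)] x by (rule abelian_subgroup.a_rcos_self)
  ultimately have "f ` (N +>\<^bsub>A\<^esub> x) = {f x}"
    by blast
  then show ?thesis
    by (simp add: quotient_lift_def)
qed

lemma quotient_lift_hom:
  assumes N: "submodule N R A" "N \<subseteq> ker"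
  shows "left_module_hom R (quotient_module A N) B quotient_lift"
  by (intro left_module_hom.intro left_module_hom_axioms.intro
      A.quotient_left_module[OF N(1)] B.left_module_axioms)
    (auto simp: A.quotient_carrier A.quotient_add[OF N(1)] A.quotient_smult[OF N(1)]
      quotient_lift_coset[OF N] hom_closed hom_add hom_smult)

lemma quotient_lift_image:
  assumes N: "submodule N R A" "N \<subseteq> ker"
  shows "quotient_lift ` carrier (quotient_module A N) = f ` carrier A"
  by (simp add: A.quotient_carrier image_image quotient_lift_coset[OF N])

end

section \<open>Cyclic modules\<close>

lemma (in ring) regular_left_module: "left_module R (regular_module R)"
proof -
  have "abelian_group (regular_module R)"
    by (rule abelian_groupI)
      (auto simp: regular_module_def a_ac intro: l_neg a_inv_closed)
  then show ?thesis
    by (intro left_module.intro ring_axioms left_module_axioms.intro)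
      (auto simp: regular_module_def l_distr r_distr m_assoc)
qed

context left_module
begin

lemma orbit_map_hom:
  assumes "m \<in> carrier M"
  shows "left_module_hom R (regular_module R) M (\<lambda>a. a \<odot>\<^bsub>M\<^esub> m)"
  using assms
  by (intro left_module_hom.intro left_module_hom_axioms.intro R.regular_left_module
      left_module_axioms)
    (auto simp: regular_module_def smult_l_distr smult_assoc1)

text \<open>The orbit of \<open>m\<close> is a submodule, and it contains \<open>m = 1 m\<close>.\<close>

lemma orbit_map_surj:
  assumes m: "m \<in> carrier M" and gen: "gen_submodule R M {m} = carrier M"
  shows "(\<lambda>a. a \<odot>\<^bsub>M\<^esub> m) ` carrier (regular_module R) = carrier M"
proof -
  interpret orb: left_module_hom R "regular_module R" M "\<lambda>a. a \<odot>\<^bsub>M\<^esub> m"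
    by (rule orbit_map_hom) fact
  have "m \<in> (\<lambda>a. a \<odot>\<^bsub>M\<^esub> m) ` carrier (regular_module R)"
    using m by (auto simp: regular_module_def intro!: image_eqI[of _ _ "\<one>\<^bsub>R\<^esub>"])
  then have "carrier M \<subseteq> (\<lambda>a. a \<odot>\<^bsub>M\<^esub> m) ` carrier (regular_module R)"
    using gen_submodule_least[OF orb.image_submodule, of "{m}"] gen by simp
  then show ?thesis
    using orb.hom_closed by blast
qed

end

section \<open>Highest weight modules as quotients of Verma modules\<close>

lemma qq_class_carrier:
  assumes "p \<in> carrier (qq_free n)"
  shows "qq_class n p \<in> carrier (qq_U n)"
  using assms by (auto simp: qq_class_def qq_U_def FactRing_def A_RCOSETS_def')

lemma letter_carrier: "g \<in> qq_gens n \<Longrightarrow> letter g \<in> carrier (qq_free n)"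
  by (simp add: qq_free_def letter_def)

lemma sc_carrier: "sc c \<in> carrier (qq_free n)"
  by (simp add: qq_free_def sc_def zero_fword_def)

lemma uK_carrier: "i \<in> {1..n} \<Longrightarrow> uK n i \<in> carrier (qq_U n)"
  and uE_carrier: "j \<in> {1..n-1} \<Longrightarrow> uE n j \<in> carrier (qq_U n)"
  and uEb_carrier: "j \<in> {1..n-1} \<Longrightarrow> uEb n j \<in> carrier (qq_U n)"
  and uscal_carrier: "uscal n c \<in> carrier (qq_U n)"
  by (auto intro!: qq_class_carrier letter_carrier sc_carrier simp: qq_gens_def)

abbreviation verma_gens :: "nat \<Rightarrow> (nat \<Rightarrow> qv) \<Rightarrow> qq_poly set set"
  where "verma_gens n \<omega> \<equiv>
    {uK n i \<ominus>\<^bsub>qq_U n\<^esub> uscal n (\<omega> i) | i. i \<in> {1..n}} \<union>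
    {uE n j | j. j \<in> {1..n-1}} \<union> {uEb n j | j. j \<in> {1..n-1}}"

lemma verma_gens_carrier:
  assumes "ring (qq_U n)"
  shows "verma_gens n \<omega> \<subseteq> carrier (qq_U n)"
  using assms uK_carrier uE_carrier uEb_carrier uscal_carrier
  by (auto intro!: abelian_group.minus_closed ring.is_abelian_group)

lemma verma_ideal_submodule:
  assumes "ring (qq_U n)"
  shows "submodule (verma_ideal n \<omega>) (qq_U n) (regular_module (qq_U n))"
proof -
  interpret U: left_module "qq_U n" "regular_module (qq_U n)"
    using assms by (rule ring.regular_left_module)
  show ?thesis
    unfolding verma_ideal_def gen_left_ideal_def
    using verma_gens_carrier[OF assms, of \<omega>]
    by (intro U.gen_submodule_submodule) (simp add: regular_module_def)
qed

text \<open>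
  The annihilator of a vector is the kernel of its orbit map, hence a left ideal, so that it suffices
  to look at the generators of \<open>I(\<omega>)\<close>: for these the claim is the definition of a highest weight
  vector.
\<close>

lemma verma_ideal_annihilates:
  assumes M: "left_module (qq_U n) M" and m: "highest_weight_vector n M \<omega> m"
  shows "verma_ideal n \<omega> \<subseteq>
    left_module_hom.ker (regular_module (qq_U n)) M (\<lambda>a. a \<odot>\<^bsub>M\<^esub> m)"
proof -
  interpret M: left_module "qq_U n" M by (rule M)
  have mM: "m \<in> carrier M"
    using m by (simp add: highest_weight_vector_def weight_space_def)
  interpret orb: left_module_hom "qq_U n" "regular_module (qq_U n)" M "\<lambda>a. a \<odot>\<^bsub>M\<^esub> m"
    using mM by (rule M.orbit_map_hom)
  have "(uK n i \<ominus>\<^bsub>qq_U n\<^esub> uscal n (\<omega> i)) \<odot>\<^bsub>M\<^esub> m = \<zero>\<^bsub>M\<^esub>" if i: "i \<in> {1..n}" for i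
  proof -
    have "uK n i \<odot>\<^bsub>M\<^esub> m = uscal n (\<omega> i) \<odot>\<^bsub>M\<^esub> m"
      using m i unfolding highest_weight_vector_def weight_space_def by blast
    then show ?thesis
      using mM i by (simp add: M.R.minus_eq M.smult_l_distr M.smult_minus_left M.M.r_neg
          uK_carrier uscal_carrier del: atLeastAtMost_iff)
  qed
  then have "\<forall>a\<in>verma_gens n \<omega>. a \<odot>\<^bsub>M\<^esub> m = \<zero>\<^bsub>M\<^esub>"
    using m by (auto simp: highest_weight_vector_def)
  then have "verma_gens n \<omega> \<subseteq> {a \<in> carrier (regular_module (qq_U n)). a \<odot>\<^bsub>M\<^esub> m = \<zero>\<^bsub>M\<^esub>}"
    using verma_gens_carrier[OF M.R.ring_axioms, of \<omega>] by (simp add: regular_module_def subset_iff)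
  then have "verma_gens n \<omega> \<subseteq> orb.ker"
    unfolding orb.ker_def .
  then show ?thesis
    unfolding verma_ideal_def gen_left_ideal_def
    by (rule orb.A.gen_submodule_least[OF orb.ker_submodule])
qed

theorem proposition3p1:
  fixes n :: nat and \<omega> :: "nat \<Rightarrow> qv" and M :: "(qq_poly set, 'm) module"
  assumes "n \<ge> 2"
    and "\<omega> \<in> weights_P n"
    and "highest_weight_module n \<omega> M"
  shows "\<exists>N. submodule N (qq_U n) (verma n \<omega>) \<and>
             left_module_isomorphic (qq_U n) M (quotient_module (verma n \<omega>) N)"
proof -
  obtain m where M: "left_module (qq_U n) M" and m: "highest_weight_vector n M \<omega> m"
    and gen: "gen_submodule (qq_U n) M {m} = carrier M"
    using assms(3) by (auto simp: highest_weight_module_def)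
  interpret M: left_module "qq_U n" M by (rule M)
  have mM: "m \<in> carrier M"
    using m by (simp add: highest_weight_vector_def weight_space_def)
  interpret orb: left_module_hom "qq_U n" "regular_module (qq_U n)" M "\<lambda>a. a \<odot>\<^bsub>M\<^esub> m"
    using mM by (rule M.orbit_map_hom)
  note I = verma_ideal_submodule[OF M.R.ring_axioms, of \<omega>] verma_ideal_annihilates[OF M m]
  interpret lift: left_module_hom "qq_U n" "verma n \<omega>" M orb.quotient_lift
    unfolding verma_def using I by (rule orb.quotient_lift_hom)
  have "orb.quotient_lift ` carrier (verma n \<omega>) = carrier M"
    unfolding verma_def using orb.quotient_lift_image[OF I] M.orbit_map_surj[OF mM gen] by simp
  then show ?thesis
    using lift.ker_submodule lift.first_isomorphism by blast
qed

end
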